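(* Let $(N,m_0)$ be an ordinary Petri net with uncontrollable transition set $T_u$, let $W=\{(\omega_1,k_1),(\omega_2,k_2),\dots,(\omega_n,k_n)\}$, $n\geq1$, be a set of linear constraints for it, and let $t\in T_u$. Then $$(Q_{\vee(W)})_t=\bigcup_{(\omega,k)\in W}(Q_{(\omega,k)})_t\ \cup\bigcup_{(i,j)\in E}C_{i\to j},$$ where $E=\{(i,j): i,j\in\{1,2,\dots,n\},\ \varpi_i(t)>0 \text{ and } \varpi_j(t)<0\}$ and $\varpi_i=\omega_i\cdot[N]$.
   Context: $\mathbb N=\{0,1,2,\dots\}$. An ordinary Petri net is $N=(P,T,F)$ with $P$ (places), $T$ (transitions) finite, nonempty, disjoint, and $F\subseteq(P\times T)\cup(T\times P)$; $T=T_u\cup T_c$ is partitioned into uncontrollable and controllable transitions. For a node $x$, ${}^\bullet x=\{y:(y,x)\in F\}$ and $x^\bullet=\{y:(x,y)\in F\}$. The incidence matrix $[N]$ has entries $[N](p,t)=-1$ if $p\in{}^\bullet t\setminus t^\bullet$, $1$ if $p\in t^\bullet\setminus{}^\bullet t$, and $0$ otherwise. A marking is a map $m:P\to\mathbb N$; $\mathcal M=\mathbb N^{|P|}$ is the set of all markings. A transition $t$ is enabled at $m$ if $m(p)>0$ for all $p\in{}^\bullet t$; then it can fire, written $m[t\rangle m'$, with $m'(p)=m(p)+[N](p,t)$. $R_t(N,m)$ is the set of markings (including $m$) reachable from $m$ by firing only $t$. For $Q\subseteq\mathcal M$, $\bar Q=\mathcal M\setminus Q$. For $Q\subseteq\mathcal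 M$ and $t\in T_u$, the escaping-marking set is $\Gamma(Q,t)=\{m\in Q:\exists m'\in R_t(N,m),\ m'\in\bar Q\}$, and the transforming marking set is $Q_t=Q\setminus\Gamma(Q,t)$. A linear constraint is a pair $(\omega,k)$ with $\omega:P\to\mathbb N$ a weight vector and $k$ an integer; it requires $\omega\cdot m\le k$. $Q_{(\omega,k)}=\{m\in\mathcal M:\omega\cdot m\le k\}$, and for a finite set $W$ of linear constraints $Q_{\vee(W)}=\bigcup_{(\omega,k)\in W}Q_{(\omega,k)}$. The weight of transitions under $(\omega,k)$ is the row vector $\varpi=\omega\cdot[N]$, i.e. $\varpi(t)=\sum_{p}\omega(p)[N](p,t)$. The complementary-marking set (relative to $t$) from $(\omega_i,k_i)$ to $(\omega_j,k_j)$ is $C_{i\to j}=\{m\in\Gamma(Q_{(\omega_i,k_i)},t)\cap\bar Q_{(\omega_j,k_j)}:\ \exists m'\in R_t(N,m)\cap Q_{(\omega_i,k_i)}\text{ such that } m'[t\rangle m''\text{ and }m''\in\bar Q_{(\omega_i,k_i)}\cap Q_{(\omega_j,k_j)}\}$. *)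

theory Defs
  imports Main "HOL-Library.FuncSet"
begin

record 'a net =
  places :: "'a set"
  transitions :: "'a set"
  flow :: "('a \<times> 'a) set"
  uncontrollable :: "'a set"
  controllable :: "'a set"

(* Arc weights are all one, since the flow is a plain relation: the net is ordinary. *)
definition ordinary_petri_net :: "'a net \<Rightarrow> bool" where
  "ordinary_petri_net N \<longleftrightarrow>
     finite (places N) \<and> places N \<noteq> {} \<and>
     finite (transitions N) \<and> transitions N \<noteq> {} \<and>
     places N \<inter> transitions N = {} \<and>
     flow N \<subseteq> (places N \<times> transitions N) \<union> (transitions N \<times> places N) \<and>
     uncontrollable N \<union> controllable N = transitions N \<and>
     uncontrollable N \<inter> controllable N = {}"

definition preset :: "'a net \<Rightarrow> 'a \<Rightarrow> 'a set" where
  "preset N x = {y. (y, x) \<in> flow N}"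

definition postset :: "'a net \<Rightarrow> 'a \<Rightarrow> 'a set" where
  "postset N x = {y. (x, y) \<in> flow N}"

definition incidence :: "'a net \<Rightarrow> 'a \<Rightarrow> 'a \<Rightarrow> int" where
  "incidence N p t =
     (if p \<in> preset N t - postset N t then -1
      else if p \<in> postset N t - preset N t then 1
      else 0)"

(* Maps from the places to the naturals; extensionality makes markings that agree
   on all places equal as functions. *)
definition markings :: "'a net \<Rightarrow> ('a \<Rightarrow> nat) set" where
  "markings N = places N \<rightarrow>\<^sub>E UNIV"

definition enabled :: "'a net \<Rightarrow> ('a \<Rightarrow> nat) \<Rightarrow> 'a \<Rightarrow> bool" where
  "enabled N m t \<longleftrightarrow> (\<forall>p \<in> preset N t. m p > 0)"

definition fires :: "'a net \<Rightarrow> 'a \<Rightarrow> ('a \<Rightarrow> nat) \<Rightarrow> ('a \<Rightarrow> nat) \<Rightarrow> bool" where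
  "fires N t m m' \<longleftrightarrow>
     m \<in> markings N \<and> m' \<in> markings N \<and> enabled N m t \<and>
     (\<forall>p \<in> places N. int (m' p) = int (m p) + incidence N p t)"

definition reach_by :: "'a net \<Rightarrow> 'a \<Rightarrow> ('a \<Rightarrow> nat) \<Rightarrow> ('a \<Rightarrow> nat) set" where
  "reach_by N t m = {m'. (fires N t)\<^sup>*\<^sup>* m m'}"

definition compl_markings :: "'a net \<Rightarrow> ('a \<Rightarrow> nat) set \<Rightarrow> ('a \<Rightarrow> nat) set" where
  "compl_markings N Q = markings N - Q"

definition escaping :: "'a net \<Rightarrow> ('a \<Rightarrow> nat) set \<Rightarrow> 'a \<Rightarrow> ('a \<Rightarrow> nat) set" where
  "escaping N Q t = {m \<in> Q. \<exists>m' \<in> reach_by N t m. m' \<in> compl_markings N Q}"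

definition transforming :: "'a net \<Rightarrow> ('a \<Rightarrow> nat) set \<Rightarrow> 'a \<Rightarrow> ('a \<Rightarrow> nat) set" where
  "transforming N Q t = Q - escaping N Q t"

type_synonym 'a constr = "('a \<Rightarrow> nat) \<times> int"

definition linear_constraint :: "'a net \<Rightarrow> 'a constr \<Rightarrow> bool" where
  "linear_constraint N c \<longleftrightarrow> fst c \<in> places N \<rightarrow>\<^sub>E UNIV"

definition admissible :: "'a net \<Rightarrow> 'a constr \<Rightarrow> ('a \<Rightarrow> nat) set" where
  "admissible N = (\<lambda>(\<omega>, k). {m \<in> markings N. int (\<Sum>p \<in> places N. \<omega> p * m p) \<le> k})"

definition admissible_or :: "'a net \<Rightarrow> 'a constr set \<Rightarrow> ('a \<Rightarrow> nat) set" where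
  "admissible_or N W = (\<Union>c \<in> W. admissible N c)"

definition transition_weight :: "'a net \<Rightarrow> ('a \<Rightarrow> nat) \<Rightarrow> 'a \<Rightarrow> int" where
  "transition_weight N \<omega> t = (\<Sum>p \<in> places N. int (\<omega> p) * incidence N p t)"

definition complementary ::
  "'a net \<Rightarrow> 'a \<Rightarrow> 'a constr \<Rightarrow> 'a constr \<Rightarrow> ('a \<Rightarrow> nat) set" where
  "complementary N t c d =
     {m \<in> escaping N (admissible N c) t \<inter> compl_markings N (admissible N d).
        \<exists>m' \<in> reach_by N t m \<inter> admissible N c.
          \<exists>m''. fires N t m' m'' \<and>
                m'' \<in> compl_markings N (admissible N c) \<inter> admissible N d}"

end

theory Submission imports Defs begin

text \<open>
  Firing \<open>t\<close> is deterministic, so the markings reachable from \<open>m\<close> by \<open>t\<close> form a chain, and along it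
  each \<open>\<omega> \<cdot> m\<close> is monotone, in the direction given by the sign of the weight of \<open>t\<close>. If \<open>m\<close> escapes
  every constraint it satisfies, these all have positive weight, so some first step \<open>m' \<rightarrow> m''\<close>
  leaves the last of them; staying in the disjunction forces \<open>m''\<close> to satisfy a constraint that \<open>m\<close>
  violates, which must have negative weight. Conversely, with such a step, everything up to \<open>m'\<close>
  satisfies the first constraint and everything from \<open>m''\<close> on satisfies the second.
\<close>

lemma fires_weight:
  assumes "fires N t m m'"
  shows "int (\<Sum>p\<in>places N. \<omega> p * m' p) =
           int (\<Sum>p\<in>places N. \<omega> p * m p) + transition_weight N \<omega> t"
  using assms by (simp add: fires_def transition_weight_def distrib_left flip: sum.distrib)

text \<open>\<open>fires\<close> fixes the successor only on the places; extensionality of markings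
  settles the rest.\<close>

lemma fires_deterministic:
  assumes "fires N t m x" and "fires N t m y"
  shows "x = y"
proof (rule PiE_ext)
  show "x \<in> places N \<rightarrow>\<^sub>E UNIV" "y \<in> places N \<rightarrow>\<^sub>E UNIV"
    using assms by (auto simp: fires_def markings_def)
  show "x p = y p" if "p \<in> places N" for p
  proof -
    have "int (x p) = int (y p)"
      using assms that by (simp add: fires_def)
    then show ?thesis by simp
  qed
qed

text \<open>Determinism leaves a single path out of \<open>m\<close>. In the induction on the run to
  \<open>x\<close>, if \<open>y\<close> lies strictly beyond \<open>u\<close>, then the first step
  from \<open>u\<close> towards \<open>y\<close> is the step to \<open>v\<close>.\<close>

lemma reach_by_linear:
  assumes "x \<in> reach_by N t m" and "y \<in> reach_by N t m"
  shows "y \<in> reach_by N t x \<or> x \<in> reach_by N t y"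
proof -
  have "(fires N t)\<^sup>*\<^sup>* m x" using assms(1) by (simp add: reach_by_def)
  then show ?thesis
  proof induction
    case base
    then show ?case using assms(2) by simp
  next
    case (step u v)
    from step.IH consider "(fires N t)\<^sup>*\<^sup>* u y" | "(fires N t)\<^sup>*\<^sup>* y u"
      unfolding reach_by_def by blast
    then show ?case
    proof cases
      case 1
      then show ?thesis
      proof (cases rule: converse_rtranclpE)
        case base
        then show ?thesis using step.hyps(2) by (simp add: reach_by_def r_into_rtranclp)
      next
        case (step w)
        then show ?thesis
          using fires_deterministic[OF \<open>fires N t u v\<close>] by (simp add: reach_by_def)
      qed
    next
      case 2
      then have "(fires N t)\<^sup>*\<^sup>* y v"
        using step.hyps(2) by (simp only: rtranclp.rtrancl_into_rtrancl)
      then show ?thesis by (simp add: reach_by_def)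
    qed
  qed
qed

lemma reach_by_markings:
  assumes "x \<in> reach_by N t m" and "m \<in> markings N"
  shows "x \<in> markings N"
proof -
  have "(fires N t)\<^sup>*\<^sup>* m x" using assms(1) by (simp add: reach_by_def)
  then show ?thesis
    \<comment> \<open>Case split on the last step: \<open>x\<close> is \<open>m\<close> itself or
      the target of a firing.\<close>
    by cases (use assms(2) in \<open>auto simp: fires_def\<close>)
qed

lemma admissible_reach_by:
  assumes "x \<in> admissible N c" and "y \<in> reach_by N t x"
    and "transition_weight N (fst c) t \<le> 0"
  shows "y \<in> admissible N c"
proof -
  have "(fires N t)\<^sup>*\<^sup>* x y" using assms(2) by (simp add: reach_by_def)
  then show ?thesis
  proof induction
    case base
    then show ?case by (rule assms(1))
  next
    case (step u v)
    then show ?case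
      using fires_weight[OF step.hyps(2), of "fst c"] assms(3)
      by (auto simp: admissible_def fires_def split: prod.splits)
  qed
qed

lemma admissible_reach_by_backwards:
  assumes "y \<in> admissible N c" and "y \<in> reach_by N t x"
    and "transition_weight N (fst c) t \<ge> 0"
  shows "x \<in> admissible N c"
proof -
  have "(fires N t)\<^sup>*\<^sup>* x y" using assms(2) by (simp add: reach_by_def)
  then show ?thesis
  proof (induction rule: converse_rtranclp_induct)
    case base
    then show ?case by (rule assms(1))
  next
    case (step u v)
    then show ?case
      using fires_weight[OF step.hyps(1), of "fst c"] assms(3)
      by (auto simp: admissible_def fires_def split: prod.splits)
  qed
qed

lemma admissible_markings: "admissible N c \<subseteq> markings N"
  by (auto simp: admissible_def split: prod.splits)

lemma admissible_or_markings: "admissible_or N W \<subseteq> markings N"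
  using admissible_markings by (auto simp: admissible_or_def)

text \<open>Since runs starting in a marking stay among the markings, avoiding the complement of
  \<open>Q\<close> is the same as staying in \<open>Q\<close>.\<close>

lemma transforming_iff:
  assumes "Q \<subseteq> markings N"
  shows "m \<in> transforming N Q t \<longleftrightarrow> m \<in> Q \<and> reach_by N t m \<subseteq> Q"
  using assms reach_by_markings[of _ N t m]
  unfolding transforming_def escaping_def compl_markings_def by blast

lemma transforming_mono:
  assumes "Q \<subseteq> Q'" and "Q' \<subseteq> markings N"
  shows "transforming N Q t \<subseteq> transforming N Q' t"
  using assms by (simp add: transforming_iff subset_iff)

text \<open>Each constraint in \<open>A\<close> is violated somewhere on the run, possibly at
  different markings. With nonnegative weights a violation persists under further firing, so the
  later of two witnesses serves for both.\<close>

lemma reach_by_outside_all: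
  assumes "finite A"
    and "\<And>c. c \<in> A \<Longrightarrow> transition_weight N (fst c) t \<ge> 0"
    and "\<And>c. c \<in> A \<Longrightarrow> \<not> reach_by N t m \<subseteq> admissible N c"
  shows "\<exists>x \<in> reach_by N t m. x \<notin> admissible_or N A"
  using assms
proof (induction A)
  case empty
  \<comment> \<open>With no constraints the disjunction is empty, so \<open>m\<close> itself is a
    witness.\<close>
  then show ?case by (auto simp: reach_by_def admissible_or_def)
next
  case (insert c A)
  obtain x where x: "x \<in> reach_by N t m" "x \<notin> admissible_or N A"
    using insert.IH insert.prems by blast
  obtain y where y: "y \<in> reach_by N t m" "y \<notin> admissible N c"
    using insert.prems(2) by blast
  from reach_by_linear[OF x(1) y(1)] show ?case
  proof
    assume "y \<in> reach_by N t x"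
    have "x \<in> admissible N d" if "y \<in> admissible N d" "d \<in> insert c A" for d
      using that(1) \<open>y \<in> reach_by N t x\<close> insert.prems(1)[OF that(2)]
      by (rule admissible_reach_by_backwards)
    then have "y \<notin> admissible_or N (insert c A)"
      using x(2) y(2) by (auto simp: admissible_or_def)
    then show ?thesis using y by blast
  next
    assume "x \<in> reach_by N t y"
    have "y \<in> admissible N d" if "x \<in> admissible N d" "d \<in> insert c A" for d
      using that(1) \<open>x \<in> reach_by N t y\<close> insert.prems(1)[OF that(2)]
      by (rule admissible_reach_by_backwards)
    then have "x \<notin> admissible_or N (insert c A)"
      using x(2) y(2) unfolding admissible_or_def by blast
    then show ?thesis using x by blast
  qed
qed

text \<open>By induction along the run: until a step out of \<open>Q\<close> has occurred, the
  current marking is still in \<open>Q\<close>.\<close>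

lemma reach_by_leaving_step:
  assumes "x \<in> reach_by N t m" and "m \<in> Q" and "x \<notin> Q"
  obtains m' m'' where "m' \<in> reach_by N t m" and "m' \<in> Q" and "fires N t m' m''" and "m'' \<notin> Q"
proof -
  have "(fires N t)\<^sup>*\<^sup>* m x" using assms(1) by (simp add: reach_by_def)
  then have "x \<in> Q \<or> (\<exists>m' m''. m' \<in> reach_by N t m \<and> m' \<in> Q \<and> fires N t m' m'' \<and> m'' \<notin> Q)"
    by induction (use assms(2) in \<open>auto simp: reach_by_def\<close>)
  then show ?thesis using assms(3) that by blast
qed

lemma complementary_subset_transforming:
  assumes "c \<in> W" and "d \<in> W"
    and "transition_weight N (fst c) t \<ge> 0" and "transition_weight N (fst d) t \<le> 0"
  shows "complementary N t c d \<subseteq> transforming N (admissible_or N W) t"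
proof
  fix m assume "m \<in> complementary N t c d"
  then obtain m' m'' where m: "m \<in> admissible N c"
    and m': "m' \<in> reach_by N t m" "m' \<in> admissible N c"
    and m'': "fires N t m' m''" "m'' \<in> admissible N d"
    by (auto simp: complementary_def escaping_def)
  have "x \<in> admissible_or N W" if x: "x \<in> reach_by N t m" for x
  proof -
    have "x \<in> admissible N c \<or> x \<in> admissible N d"
      using reach_by_linear[OF m'(1) x]
    proof
      assume "m' \<in> reach_by N t x"
      then show ?thesis
        using admissible_reach_by_backwards[OF m'(2) _ assms(3)] by simp
    next
      assume "x \<in> reach_by N t m'"
      then have "(fires N t)\<^sup>*\<^sup>* m' x" by (simp add: reach_by_def)
      then show ?thesis
      \<comment> \<open>Beyond \<open>m'\<close> the run must pass through \<open>m''\<close>, where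
        \<open>d\<close> takes over from \<open>c\<close>.\<close>
      proof (cases rule: converse_rtranclpE)
        case base
        then show ?thesis using m'(2) by simp
      next
        case (step u)
        then have "x \<in> reach_by N t m''"
          using fires_deterministic[OF m''(1) step(1)] by (simp add: reach_by_def)
        then show ?thesis
          using admissible_reach_by[OF m''(2) _ assms(4)] by simp
      qed
    qed
    then show ?thesis using assms(1,2) by (auto simp: admissible_or_def)
  qed
  moreover have "m \<in> admissible_or N W"
    using m assms(1) unfolding admissible_or_def by blast
  ultimately show "m \<in> transforming N (admissible_or N W) t"
    by (auto simp: transforming_iff[OF admissible_or_markings])
qed

lemma transforming_cases:
  assumes "finite W" and m: "m \<in> transforming N (admissible_or N W) t"
    and none: "\<And>c. c \<in> W \<Longrightarrow> m \<notin> transforming N (admissible N c) t"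
  obtains c d where "c \<in> W" and "d \<in> W" and "transition_weight N (fst c) t > 0"
    and "transition_weight N (fst d) t < 0" and "m \<in> complementary N t c d"
proof -
  \<comment> \<open>The run will be shown to leave \<open>A\<close> as a whole while staying in
    \<open>W\<close>, so a constraint violated by \<open>m\<close> must take over.\<close>
  define A where "A = {c \<in> W. m \<in> admissible N c}"
  have m_or: "m \<in> admissible_or N W" and stays: "reach_by N t m \<subseteq> admissible_or N W"
    and mark: "m \<in> markings N"
    using m admissible_or_markings by (auto simp: transforming_iff[OF admissible_or_markings])
  have escapes: "\<not> reach_by N t m \<subseteq> admissible N c" if "c \<in> A" for c
    using that none[of c] by (simp add: A_def transforming_iff[OF admissible_markings])
  have pos: "transition_weight N (fst c) t > 0" if "c \<in> A" for c
  proof (rule ccontr)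
    assume "\<not> transition_weight N (fst c) t > 0"
    then have "reach_by N t m \<subseteq> admissible N c"
      using that admissible_reach_by[of m N c] by (auto simp: A_def)
    then show False using escapes[OF that] by simp
  qed
  obtain x where x: "x \<in> reach_by N t m" "x \<notin> admissible_or N A"
  proof -
    have "finite A" using assms(1) by (simp add: A_def)
    then show ?thesis
      using that reach_by_outside_all[OF _ less_imp_le[OF pos] escapes] by blast
  qed
  have "m \<in> admissible_or N A"
    using m_or by (auto simp: A_def admissible_or_def)
  then obtain m' m'' where m': "m' \<in> reach_by N t m" "m' \<in> admissible_or N A"
    and m'': "fires N t m' m''" "m'' \<notin> admissible_or N A"
    using reach_by_leaving_step[OF x(1) _ x(2)] by blast
  have r'': "m'' \<in> reach_by N t m"
    using m'(1) m''(1) by (auto simp: reach_by_def)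
  \<comment> \<open>Any member of \<open>A\<close> that holds at \<open>m'\<close> will do:
    \<open>m''\<close> violates all of \<open>A\<close>.\<close>
  obtain c where c: "c \<in> A" "m' \<in> admissible N c"
    using m'(2) by (auto simp: admissible_or_def)
  obtain d where d: "d \<in> W" "m'' \<in> admissible N d"
    using r'' stays by (auto simp: admissible_or_def)
  have md: "m \<notin> admissible N d"
    using d m''(2) unfolding A_def admissible_or_def by blast
  \<comment> \<open>With nonnegative weight, \<open>d\<close> would carry back from
    \<open>m''\<close> to \<open>m\<close>.\<close>
  then have neg: "transition_weight N (fst d) t < 0"
    using admissible_reach_by_backwards[OF d(2) r''] by fastforce
  have "m'' \<notin> admissible N c"
    using c(1) m''(2) unfolding admissible_or_def by blast
  moreover have "m'' \<in> markings N"
    using m''(1) by (simp add: fires_def)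
  \<comment> \<open>\<open>m''\<close> is both the marking at which \<open>d\<close> takes over and
    the witness that \<open>m\<close> escapes \<open>c\<close>.\<close>
  ultimately have "m \<in> complementary N t c d"
    using c d m'(1) m''(1) r'' md mark
    unfolding complementary_def escaping_def compl_markings_def A_def by blast
  then show ?thesis
    using that[of c d] c(1) d(1) pos[OF c(1)] neg by (simp add: A_def)
qed


theorem corollary3:
  fixes N :: "'a net" and m0 :: "'a \<Rightarrow> nat" and t :: 'a
    and n :: nat and \<omega> :: "nat \<Rightarrow> 'a \<Rightarrow> nat" and k :: "nat \<Rightarrow> int"
    and W :: "'a constr set" and E :: "(nat \<times> nat) set"
  assumes "ordinary_petri_net N" and "m0 \<in> markings N"
    and "n \<ge> 1"
    and "W = (\<lambda>i. (\<omega> i, k i)) ` {1..n}"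
    and "\<forall>c \<in> W. linear_constraint N c"
    and "t \<in> uncontrollable N"
    and "E = {(i, j). i \<in> {1..n} \<and> j \<in> {1..n} \<and>
              transition_weight N (\<omega> i) t > 0 \<and> transition_weight N (\<omega> j) t < 0}"
  shows "transforming N (admissible_or N W) t =
           (\<Union>c \<in> W. transforming N (admissible N c) t) \<union>
           (\<Union>(i, j) \<in> E. complementary N t (\<omega> i, k i) (\<omega> j, k j))"
proof
  let ?L = "transforming N (admissible_or N W) t"
  let ?R = "(\<Union>c \<in> W. transforming N (admissible N c) t) \<union>
           (\<Union>(i, j) \<in> E. complementary N t (\<omega> i, k i) (\<omega> j, k j))"
  show "?L \<subseteq> ?R"
  proof
    fix m assume m: "m \<in> ?L"
    show "m \<in> ?R"
    proof (rule ccontr)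
      assume notin: "m \<notin> ?R"
      have "finite W" using assms(4) by simp
      moreover have "m \<notin> transforming N (admissible N c) t" if "c \<in> W" for c
        using notin that by blast
      ultimately obtain c d where cd: "c \<in> W" "d \<in> W" "transition_weight N (fst c) t > 0"
        "transition_weight N (fst d) t < 0" "m \<in> complementary N t c d"
        by (rule transforming_cases[OF _ m])
      \<comment> \<open>\<open>E\<close> ranges over indices, so any indices representing
        \<open>c\<close> and \<open>d\<close> are chosen.\<close>
      obtain i j where "i \<in> {1..n}" "c = (\<omega> i, k i)" "j \<in> {1..n}" "d = (\<omega> j, k j)"
        using cd(1,2) assms(4) by blast
      then have "(i, j) \<in> E" "m \<in> complementary N t (\<omega> i, k i) (\<omega> j, k j)"
        using cd(3-5) assms(7) by auto
      then show False using notin by blast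
    qed
  qed
  show "?R \<subseteq> ?L"
  proof (intro Un_least UN_least)
    fix c assume "c \<in> W"
    then show "transforming N (admissible N c) t \<subseteq> ?L"
      by (intro transforming_mono admissible_or_markings) (auto simp: admissible_or_def)
  next
    fix e assume "e \<in> E"
    then obtain i j where ij: "e = (i, j)" "i \<in> {1..n}" "j \<in> {1..n}"
      "transition_weight N (\<omega> i) t > 0" "transition_weight N (\<omega> j) t < 0"
      using assms(7) by auto
    then show "(case e of (i, j) \<Rightarrow> complementary N t (\<omega> i, k i) (\<omega> j, k j)) \<subseteq> ?L"
      using complementary_subset_transforming[of "(\<omega> i, k i)" W "(\<omega> j, k j)" N t] assms(4)
      by simp
  qed
qed

end
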